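(* Let $h$ and $k$ be positive integers with $3 \leq h \leq k-1$, and let $A$ be a set of $k$ integers such that $A \cap (-A) = \emptyset$. Then \[|h^{\wedge}_{\pm}A| \geq 2hk - h^2 + 1.\] This lower bound is best possible: for all such $h,k$ there is such a set $A$ attaining equality.
   Context: For a finite set $A = \{a_1, \ldots, a_k\}$ of integers (with distinct $a_i$) and a positive integer $h$, the restricted $h$-fold signed sumset is \[h^{\wedge}_{\pm}A = \left\{ \sum_{i=1}^{k} \lambda_i a_i : \lambda_i \in \{-1,0,1\}, \ \sum_{i=1}^{k} |\lambda_i| = h \right\}.\] $-A = \{-a : a \in A\}$. *)

theory Defs
  imports Main
begin

definition restricted_signed_sumset :: "nat \<Rightarrow> int set \<Rightarrow> int set" where
  "restricted_signed_sumset h A =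
     {(\<Sum>a\<in>A. c a * a) | c :: int \<Rightarrow> int.
        (\<forall>a\<in>A. c a \<in> {-1, 0, 1}) \<and> (\<Sum>a\<in>A. \<bar>c a\<bar>) = int h}"

end

theory Submission
  imports Defs
begin

text \<open>
  Only absolute values matter, so let \<open>A\<close> consist of positive integers. Adding a new maximum to
  \<open>A\<close> creates \<open>h\<close> sums above and \<open>h\<close> sums below all previous ones, which reduces the bound to
  \<open>card A = h + 1\<close>. There exactly one element \<open>i\<close> is omitted, and up to translation by \<open>\<Sum>A\<close> the
  sums are \<open>i + 2 * \<Sum>J\<close> with \<open>J \<subseteq> A - {i}\<close>; at least \<open>(card A)\<^sup>2\<close> of them are needed.

  Let \<open>a\<close> and \<open>b\<close> be the minimum and maximum of \<open>A\<close>. The sums with \<open>b \<in> J\<close> are those of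
  \<open>A - {b}\<close> translated by \<open>2b\<close> and all are at least \<open>a + 2b\<close>, so by induction on \<open>card A\<close> it
  suffices to find \<open>2 * card A - 1\<close> sums below \<open>a + 2b\<close>. The elements of \<open>A\<close> are such sums, and
  \<open>card A - 1\<close> further ones of the form \<open>i + 2j\<close> exist unless \<open>A = {a, 3a, 5a}\<close>. An element \<open>x\<close>
  with \<open>2x\<close> close to \<open>b\<close> provides them as \<open>i + 2x\<close>. Without such an \<open>x\<close>, take \<open>b + 2l\<close> for the
  small and \<open>a + 2h\<close> for the large elements; if two of these coincide, then \<open>2l\<close> and \<open>2h\<close> are
  congruent modulo \<open>b - a\<close> and together move nearly all of \<open>A\<close> into one window of that length. In
  the boundary cases one sum is missing at first; it can only fail to exist if \<open>A\<close> is essentially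
  an arithmetic progression of difference \<open>2a\<close>, where it is found explicitly.
\<close>

section \<open>Sums that omit one element, and fresh sums among them\<close>

definition omit_one_sums :: "int set \<Rightarrow> int set" where
  "omit_one_sums A = {i + 2 * \<Sum>J | i J. i \<in> A \<and> J \<subseteq> A - {i}}"

lemma omit_one_sums_memI:
  "i \<in> A \<Longrightarrow> J \<subseteq> A - {i} \<Longrightarrow> z = i + 2 * \<Sum>J \<Longrightarrow> z \<in> omit_one_sums A"
  unfolding omit_one_sums_def by blast

lemma omit_one_sums_mono: "A \<subseteq> B \<Longrightarrow> omit_one_sums A \<subseteq> omit_one_sums B"
  unfolding omit_one_sums_def by blast

lemma finite_omit_one_sums:
  assumes "finite A"
  shows "finite (omit_one_sums A)"
proof -
  have "omit_one_sums A \<subseteq> (\<lambda>(i, J). i + 2 * \<Sum>J) ` (A \<times> Pow A)"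
    unfolding omit_one_sums_def by auto
  thus ?thesis using assms finite_subset by blast
qed

text \<open>Members of \<open>A\<close> are removed because they are already sums with empty
  \<open>J\<close> and are counted separately. For positive \<open>A\<close> the cutoff
  \<open>Min A + 2 * Max A\<close> bounds from below all sums with the maximum in \<open>J\<close>,
  so fresh sums never collide with those.\<close>

definition fresh_sums :: "int set \<Rightarrow> int set" where
  "fresh_sums A = {i + 2 * j | i j. i \<in> A \<and> j \<in> A \<and> i \<noteq> j \<and> i + 2 * j < Min A + 2 * Max A} - A"

lemma finite_fresh_sums:
  assumes "finite A"
  shows "finite (fresh_sums A)"
proof -
  have "fresh_sums A \<subseteq> (\<lambda>(i, j). i + 2 * j) ` (A \<times> A)"
    unfolding fresh_sums_def by auto
  thus ?thesis using assms finite_subset by blast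
qed

section \<open>Counting the fresh sums of a finite set of positive integers\<close>

locale positive_set =
  fixes A :: "int set" and a b :: int
  assumes fin: "finite A" and a_in: "a \<in> A" and b_in: "b \<in> A"
    and a_le: "\<And>x. x \<in> A \<Longrightarrow> a \<le> x" and le_b: "\<And>x. x \<in> A \<Longrightarrow> x \<le> b"
    and a_pos: "0 < a" and a_less_b: "a < b"
begin

lemma Min_eq: "Min A = a"
  using fin a_in a_le by (simp add: Min_eqI)

lemma Max_eq: "Max A = b"
  using fin b_in le_b by (simp add: Max_eqI)

lemma fresh_memI:
  assumes "i \<in> A" "j \<in> A" "i \<noteq> j" "z = i + 2 * j" "z < a + 2 * b" "z \<notin> A"
  shows "z \<in> fresh_sums A"
  unfolding fresh_sums_def Min_eq Max_eq using assms by auto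

lemma card_fresh_ge:
  assumes "inj_on f B" "f ` B \<subseteq> fresh_sums A"
  shows "card B \<le> card (fresh_sums A)"
  using assms card_inj_on_le finite_fresh_sums[OF fin] by blast

lemma card_fresh_ge_Suc:
  assumes "inj_on f B" "f ` B \<subseteq> fresh_sums A" "z \<in> fresh_sums A" "z \<notin> f ` B" "finite B"
  shows "card B + 1 \<le> card (fresh_sums A)"
proof -
  have "card (insert z (f ` B)) \<le> card (fresh_sums A)"
    using assms finite_fresh_sums[OF fin] by (intro card_mono) auto
  moreover have "card (insert z (f ` B)) = card B + 1"
    using assms by (simp add: card_image)
  ultimately show ?thesis by simp
qed

lemma closed_add_mult:
  assumes closed: "\<And>y. y \<in> A \<Longrightarrow> y \<noteq> a \<Longrightarrow> y + 2 * a \<le> b \<Longrightarrow> y + 2 * a \<in> A"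
    and "y \<in> A" "y \<noteq> a" "y + 2 * a * int k \<le> b"
  shows "y + 2 * a * int k \<in> A"
  using assms(4)
proof (induction k)
  case 0
  show ?case using assms(2) by simp
next
  case (Suc k)
  have eq: "y + 2 * a * int (Suc k) = (y + 2 * a * int k) + 2 * a" by (simp add: algebra_simps)
  have "y + 2 * a * int k \<le> b" using Suc.prems a_pos by (simp add: algebra_simps)
  with Suc.IH have 1: "y + 2 * a * int k \<in> A" by simp
  have "a < y" using a_le[OF assms(2)] assms(3) by simp
  moreover have "0 \<le> 2 * a * int k" using a_pos by simp
  ultimately have "y + 2 * a * int k \<noteq> a" by linarith
  from closed[OF 1 this] Suc.prems show ?case unfolding eq by blast
qed

text \<open>The walk in steps of \<open>2 * a\<close> stays in \<open>A\<close>, which is bounded,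
  so it has to stop, and it can stop only at \<open>b\<close>.\<close>

lemma progression_to_max:
  assumes step: "\<And>y. y \<in> A \<Longrightarrow> y \<noteq> a \<Longrightarrow> y \<noteq> b \<Longrightarrow> y + 2 * a \<in> A"
    and "y \<in> A" "y \<noteq> a"
  shows "\<exists>k::nat. b = y + 2 * a * int k"
  using assms(2,3)
proof (induction "nat (b - y)" arbitrary: y rule: less_induct)
  case less
  show ?case
  proof (cases "y = b")
    case True
    thus ?thesis by (intro exI[of _ 0]) simp
  next
    case False
    have y2: "y + 2 * a \<in> A" using step less.prems False by simp
    have "y + 2 * a \<noteq> a" using a_le[OF less.prems(1)] a_pos by linarith
    moreover have "nat (b - (y + 2 * a)) < nat (b - y)"
      using le_b[OF less.prems(1)] False a_pos by linarith
    ultimately obtain k where "b = (y + 2 * a) + 2 * a * int k"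
      using less.hyps y2 by blast
    thus ?thesis by (intro exI[of _ "Suc k"]) (simp add: algebra_simps)
  qed
qed

text \<open>Since \<open>y < b\<close>, a missing \<open>y + 2 * a\<close> would itself be a fresh
  sum below \<open>b + 2 * a\<close>.\<close>

lemma closed_of_no_short_fresh:
  assumes "\<And>z. z \<in> fresh_sums A \<Longrightarrow> b + 2 * a \<le> z"
    and "y \<in> A" "y \<noteq> a" "y \<noteq> b"
  shows "y + 2 * a \<in> A"
proof (rule ccontr)
  assume n: "y + 2 * a \<notin> A"
  have "y < b" using le_b[OF assms(2)] assms(4) by simp
  hence "y + 2 * a \<in> fresh_sums A"
    using a_in assms n a_less_b by (intro fresh_memI[of y a]) auto
  from assms(1)[OF this] \<open>y < b\<close> show False by simp
qed

text \<open>For \<open>i\<close> from \<open>a\<close> to \<open>b\<close> the bounds on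
  \<open>2 * x\<close> place \<open>i + 2 * x\<close> strictly between \<open>b\<close> and the
  cutoff; only \<open>i = x\<close> is lost.\<close>

lemma fresh_if_near_half:
  assumes x: "x \<in> A" "b - a < 2 * x" "2 * x < b + a"
  shows "card A - 1 \<le> card (fresh_sums A)"
proof -
  have "card (A - {x}) \<le> card (fresh_sums A)"
  proof (rule card_fresh_ge)
    show "inj_on (\<lambda>i. i + 2 * x) (A - {x})" by (auto simp: inj_on_def)
    show "(\<lambda>i. i + 2 * x) ` (A - {x}) \<subseteq> fresh_sums A"
    proof (rule image_subsetI)
      fix i assume "i \<in> A - {x}"
      hence i: "i \<in> A" "i \<noteq> x" by auto
      have "b < i + 2 * x" using a_le[OF i(1)] x by linarith
      moreover have "i + 2 * x < a + 2 * b" using le_b[OF i(1)] x by linarith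
      ultimately show "i + 2 * x \<in> fresh_sums A"
        using i x le_b by (intro fresh_memI[of i x]) force+
    qed
  qed
  thus ?thesis using x fin by simp
qed

text \<open>Here \<open>b + 2 * x\<close> equals the cutoff, so translation by \<open>2 * x\<close>
  loses \<open>b\<close> as well as \<open>x\<close>. If the translates were the only fresh sums,
  \<open>A\<close> would consist of \<open>a\<close> and progressions of difference
  \<open>2 * a\<close> ending at \<open>b\<close>, and another fresh sum could be written
  down.\<close>

lemma fresh_if_upper_half:
  assumes x: "x \<in> A" "2 * x = b + a" and exc: "A \<noteq> {a, 3 * a, 5 * a}"
  shows "card A - 1 \<le> card (fresh_sums A)"
proof -
  let ?B = "A - {x, b}"
  let ?f = "\<lambda>i. i + 2 * x"
  have xb: "x < b" "a < x" using x a_less_b by linarith+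
  have inj: "inj_on ?f ?B" by (auto simp: inj_on_def)
  have sub: "?f ` ?B \<subseteq> fresh_sums A"
  proof (rule image_subsetI)
    fix i assume "i \<in> ?B"
    hence i: "i \<in> A" "i \<noteq> x" "i \<noteq> b" by auto
    have "i < b" using le_b[OF i(1)] i by simp
    moreover have "b < i + 2 * x" using a_le[OF i(1)] x a_pos by linarith
    ultimately show "i + 2 * x \<in> fresh_sums A"
      using i x le_b by (intro fresh_memI[of i x]) force+
  qed
  have cardA: "card ?B + 1 = card A - 1"
  proof -
    have "card ?B = card A - card {x, b}" using x b_in by (intro card_Diff_subset) auto
    moreover have "card {x, b} = 2" using xb by simp
    moreover have "card {a, x, b} \<le> card A" using fin a_in b_in x by (intro card_mono) auto
    moreover have "card {a, x, b} = 3" using xb by simp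
    ultimately show ?thesis by simp
  qed
  have "\<exists>z. z \<in> fresh_sums A \<and> z \<notin> ?f ` ?B"
  proof (rule ccontr)
    assume "\<not> ?thesis"
    hence all: "\<And>z. z \<in> fresh_sums A \<Longrightarrow> z \<in> ?f ` ?B" by blast
    \<comment> \<open>Each translate is at least \<open>a + 2 * x\<close>, which is
      \<open>b + 2 * a\<close>.\<close>
    have low: "b + 2 * a \<le> z" if "z \<in> fresh_sums A" for z
      using all[OF that] a_le x by fastforce
    have step: "\<And>y. y \<in> A \<Longrightarrow> y \<noteq> a \<Longrightarrow> y \<noteq> b \<Longrightarrow> y + 2 * a \<in> A"
      using closed_of_no_short_fresh[OF low] by blast
    have closed: "\<And>y. y \<in> A \<Longrightarrow> y \<noteq> a \<Longrightarrow> y + 2 * a \<le> b \<Longrightarrow> y + 2 * a \<in> A"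
      using step a_pos by force
    \<comment> \<open>With \<open>2 * x = b + a\<close> this places \<open>x\<close> and
      \<open>b\<close> at \<open>k\<close> and \<open>2 * k\<close> steps of length
      \<open>2 * a\<close> above \<open>a\<close>; \<open>k = 1\<close> leads to the excluded
      set.\<close>
    obtain k where k: "b = x + 2 * a * int k" using progression_to_max[OF step x(1)] xb by auto
    have xk: "x = a + 2 * a * int k" using k x by linarith
    have bk: "b = a + 4 * a * int k" using k xk by linarith
    have k0: "k \<noteq> 0" using xk xb by (cases k) auto
    show False
    proof (cases "k = 1")
      case True
      have "A = {a, 3 * a, 5 * a}"
      proof
        show "{a, 3 * a, 5 * a} \<subseteq> A" using a_in b_in x(1) xk bk True by simp
        show "A \<subseteq> {a, 3 * a, 5 * a}"
        proof
          fix y assume y: "y \<in> A"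
          show "y \<in> {a, 3 * a, 5 * a}"
          proof (cases "y = a")
            case False
            then obtain q where q: "b = y + 2 * a * int q" using progression_to_max[OF step y] by auto
            have "a < y" using a_le[OF y] False by simp
            hence "2 * a * int q < 2 * a * 2" using q bk True by simp
            hence "int q < 2" using a_pos by (simp add: mult_less_cancel_left_pos)
            hence "q = 0 \<or> q = 1" by linarith
            thus ?thesis using q bk True by auto
          qed simp
        qed
      qed
      thus False using exc by simp
    next
      case False
      hence k2: "2 \<le> k" using k0 by simp
      have ak: "2 * a \<le> a * int k" using k2 a_pos by (simp add: mult.commute)
      have x4b: "x + 4 * a \<le> b" using xk bk ak by linarith
      hence x2: "x + 2 * a \<in> A" using closed[OF x(1)] xb a_pos by simp
      have x4: "x + 4 * a \<in> A" using closed[OF x2] x4b xb a_pos by (simp add: add.commute)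
      show False
      proof (cases "x - 2 * a \<in> A")
        case True
        \<comment> \<open>As a translate, \<open>3 * x\<close> would have to come from
          \<open>i = x\<close>, which is not allowed; \<open>(x + 4 * a) + 2 * (x - 2 * a)\<close>
          realizes it all the same.\<close>
        have "3 * x \<in> fresh_sums A"
        proof (rule fresh_memI[OF x4 True])
          show "x + 4 * a \<noteq> x - 2 * a" using a_pos by simp
          show "3 * x < a + 2 * b" using x xb by linarith
          show "3 * x \<notin> A" using le_b[of "3 * x"] x xb a_pos by force
        qed simp
        from all[OF this] show False by auto
      next
        case False
        have ge_x: "x \<le> y" if y: "y \<in> A" "y \<noteq> a" for y
        proof (rule ccontr)
          assume "\<not> x \<le> y"
          obtain q where q: "b = y + 2 * a * int q" using progression_to_max[OF step y] by auto
          have "2 * a * int k < 2 * a * int q" using q k \<open>\<not> x \<le> y\<close> by linarith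
          hence "k < q" using a_pos by (simp add: mult_less_cancel_left_pos)
          then obtain r where r: "q = k + 1 + r" by (metis less_iff_Suc_add add.commute add_Suc_right Suc_eq_plus1 add.assoc)
          have "y + 2 * a * int r = x - 2 * a" using q k r by (simp add: algebra_simps)
          moreover have "y + 2 * a * int r \<in> A"
            using closed_add_mult[OF closed y, of r] calculation xb a_pos by simp
          ultimately show False using False by simp
        qed
        \<comment> \<open>The value is \<open>5 * a + 2 * x\<close>. As a translate it forces
          \<open>5 * a\<close> into \<open>A - {x, b}\<close>, hence above \<open>x\<close>, whereas
          \<open>k \<ge> 2\<close> gives \<open>5 * a \<le> x\<close>.\<close>
        have "a + 2 * (x + 2 * a) \<in> fresh_sums A"
        proof (rule fresh_memI[OF a_in x2])
          show "a \<noteq> x + 2 * a" using xb a_pos by simp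
          show "a + 2 * (x + 2 * a) < a + 2 * b" using x4b a_pos by simp
          show "a + 2 * (x + 2 * a) \<notin> A" using le_b[of "a + 2 * (x + 2 * a)"] x a_pos by force
        qed simp
        from all[OF this] have "5 * a \<in> A - {x, b}" by (auto simp: algebra_simps)
        moreover have "5 * a \<noteq> a" using a_pos by simp
        ultimately have "x < 5 * a" using ge_x[of "5 * a"] by force
        thus False using xk ak by linarith
      qed
    qed
  qed
  then obtain z where "z \<in> fresh_sums A" "z \<notin> ?f ` ?B" by blast
  from card_fresh_ge_Suc[OF inj sub this] fin cardA show ?thesis by simp
qed

text \<open>Now \<open>a + 2 * x = b\<close> is a member, so translation by \<open>2 * x\<close>
  loses both \<open>a\<close> and \<open>x\<close>; for \<open>x = a\<close> this is a single loss.
  Otherwise a pigeonhole argument on progressions of difference \<open>2 * a\<close> supplies one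
  more sum.\<close>

lemma fresh_if_lower_half:
  assumes x: "x \<in> A" "2 * x = b - a"
  shows "card A - 1 \<le> card (fresh_sums A)"
proof -
  let ?f = "\<lambda>i. i + 2 * x"
  have f_fresh: "?f i \<in> fresh_sums A" if i: "i \<in> A" "i \<noteq> a" "i \<noteq> x" for i
  proof -
    have "a < i" using a_le[OF i(1)] i by simp
    moreover have "i + 2 * x < a + 2 * b" using le_b[OF i(1)] x a_pos by linarith
    ultimately show ?thesis using i x le_b by (intro fresh_memI[of i x]) force+
  qed
  show ?thesis
  proof (cases "x = a")
    case True
    have "card (A - {a}) \<le> card (fresh_sums A)"
      by (rule card_fresh_ge[of ?f]) (use f_fresh True in \<open>auto simp: inj_on_def\<close>)
    thus ?thesis using a_in fin by simp
  next
    case xa: False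
    let ?B = "A - {a, x}"
    have ax: "a < x" using a_le[OF x(1)] xa by simp
    have inj: "inj_on ?f ?B" by (auto simp: inj_on_def)
    have sub: "?f ` ?B \<subseteq> fresh_sums A" using f_fresh by auto
    have cardA: "card ?B + 1 = card A - 1"
    proof -
      have xb: "x < b" using x a_pos ax by linarith
      have "card ?B = card A - card {a, x}" using x a_in by (intro card_Diff_subset) auto
      moreover have "card {a, x} = 2" using ax by simp
      moreover have "card {a, x, b} \<le> card A" using fin a_in b_in x by (intro card_mono) auto
      moreover have "card {a, x, b} = 3" using ax xb by simp
      ultimately show ?thesis by simp
    qed
    have "\<exists>z. z \<in> fresh_sums A \<and> z \<notin> ?f ` ?B"
    proof (rule ccontr)
      assume "\<not> ?thesis"
      hence all: "\<And>z. z \<in> fresh_sums A \<Longrightarrow> z \<in> ?f ` ?B" by blast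
      have low: "b < z" if "z \<in> fresh_sums A" for z
        using all[OF that] a_le x by fastforce
      have closed: "y + 2 * a \<in> A" if y: "y \<in> A" "y \<noteq> a" "y + 2 * a \<le> b" for y
      proof (rule ccontr)
        assume "y + 2 * a \<notin> A"
        hence "y + 2 * a \<in> fresh_sums A"
          using y a_in a_less_b a_pos by (intro fresh_memI[of y a]) auto
        from low[OF this] y show False by simp
      qed
      \<comment> \<open>Above \<open>b\<close>, the sum \<open>y + 2 * a\<close> must be a translate
        \<open>i + (b - a)\<close>. Solving for \<open>i\<close> carries the last window of length
        \<open>2 * a\<close> to the first one above \<open>a\<close>.\<close>
      have top: "y + 3 * a - b \<in> ?B" if y: "y \<in> A" "b < y + 2 * a" for y
      proof -
        have "y \<noteq> a" using y ax x by linarith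
        moreover have "y + 2 * a < a + 2 * b" using le_b[OF y(1)] a_less_b by linarith
        ultimately have "y + 2 * a \<in> fresh_sums A"
          using y a_in le_b by (intro fresh_memI[of y a]) force+
        from all[OF this] obtain i where "i \<in> ?B" "y + 2 * a = i + 2 * x" by auto
        moreover from this have "i = y + 3 * a - b" using x by linarith
        ultimately show ?thesis by simp
      qed
      have a3: "3 * a \<in> A" using top[OF b_in] a_pos by simp
      have x_minus: "x - 2 * a \<notin> A"
      proof
        assume xm: "x - 2 * a \<in> A"
        have "3 * a \<le> x" using a_le[OF xm] by simp
        hence x4: "x + 4 * a \<in> A"
          using closed_add_mult[OF closed x(1) xa, of 2] x by simp
        have "3 * x \<in> fresh_sums A"
        proof (rule fresh_memI[OF x4 xm])
          show "x + 4 * a \<noteq> x - 2 * a" using a_pos by simp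
          show "3 * x < a + 2 * b" using x ax a_pos by linarith
          show "3 * x \<notin> A" using le_b[of "3 * x"] x ax by force
        qed simp
        from all[OF this] show False by auto
      qed
      txt \<open>Follow the progression of difference \<open>2a\<close> from each starting point up to the last
        window below \<open>b\<close>, and translate that window back to the first one: this is injective,
        although the starting points outnumber the targets by one.\<close>
      let ?U = "insert x {y \<in> A. a < y \<and> y \<le> 3 * a}"
      let ?V = "{y \<in> A. a < y \<and> y \<le> 3 * a} - {x}"
      define q where "q u = (b - u) div (2 * a)" for u
      let ?p = "\<lambda>u. u + 2 * a * q u + 3 * a - b"
      have U: "u \<in> A" "a < u" "u \<le> b" if "u \<in> ?U" for u
        using that x ax le_b by auto
      have win: "b - 2 * a < u + 2 * a * q u" "u + 2 * a * q u \<le> b" for u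
      proof -
        have "b - u = 2 * a * q u + (b - u) mod (2 * a)" unfolding q_def by simp
        moreover have "0 \<le> (b - u) mod (2 * a)" "(b - u) mod (2 * a) < 2 * a" using a_pos by simp_all
        ultimately show "b - 2 * a < u + 2 * a * q u" "u + 2 * a * q u \<le> b" by linarith+
      qed
      have p_in: "?p ` ?U \<subseteq> ?V"
      proof
        fix v assume "v \<in> ?p ` ?U"
        then obtain u where u: "u \<in> ?U" "v = ?p u" by blast
        have "0 \<le> q u" unfolding q_def using U(3)[OF u(1)] a_pos by (simp add: pos_imp_zdiv_nonneg_iff)
        then obtain r where r: "q u = int r" using nonneg_int_cases by blast
        have "u + 2 * a * q u \<in> A"
          using closed_add_mult[OF closed, of u r] U[OF u(1)] win(2)[of u] r by simp
        moreover have "b < u + 2 * a * q u + 2 * a" "a < v" "v \<le> 3 * a" using win[of u] u(2) by linarith+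
        ultimately show "v \<in> ?V" using top[of "u + 2 * a * q u"] u(2) by simp
      qed
      have p_inj: "inj_on ?p ?U"
      proof -
        \<comment> \<open>Equal images differ by a multiple of \<open>2 * a\<close> at the start, so
          the larger start exceeds \<open>3 * a\<close> and must be \<open>x\<close>; the
          progression from the smaller one would then pass through \<open>x - 2 * a\<close>.\<close>
        have less: "False" if "u \<in> ?U" "v \<in> ?U" "?p u = ?p v" "u < v" for u v
        proof -
          have eq: "v = u + 2 * a * (q u - q v)" using that(3) by (simp add: algebra_simps)
          have "0 < 2 * a * (q u - q v)" using eq that(4) by linarith
          hence pos: "0 < q u - q v" using a_pos by (simp add: zero_less_mult_iff)
          then obtain r where r: "q u - q v = 1 + int r" using zless_iff_Suc_zadd[of 0 "q u - q v"] by auto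
          have v: "v = u + 2 * a + 2 * a * int r" using eq r by (simp add: algebra_simps)
          have "0 \<le> 2 * a * int r" using a_pos by simp
          hence "3 * a < v" using v U(2)[OF that(1)] by linarith
          hence "v = x" using that(2) by auto
          hence "u + 2 * a * int r = x - 2 * a" using v by simp
          moreover have "u + 2 * a * int r \<in> A"
            using closed_add_mult[OF closed, of u r] U[OF that(1)] calculation le_b[OF x(1)] a_pos by simp
          ultimately show False using x_minus by simp
        qed
        show ?thesis
        proof (rule inj_onI)
          fix u v assume uv: "u \<in> ?U" "v \<in> ?U" "?p u = ?p v"
          from less[OF uv] less[OF uv(2,1) uv(3)[symmetric]] show "u = v" by (cases u v rule: linorder_cases) auto
        qed
      qed
      have "card ?U \<le> card ?V" by (rule card_inj_on_le[OF p_inj p_in]) (use fin in simp)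
      moreover have "card ?V < card ?U" by (rule psubset_card_mono) (use fin in auto)
      ultimately show False by simp
    qed
    then obtain z where "z \<in> fresh_sums A" "z \<notin> ?f ` ?B" by blast
    from card_fresh_ge_Suc[OF inj sub this] fin cardA show ?thesis by simp
  qed
qed

lemma fresh_if_half_avoided:
  assumes gap: "\<And>x. x \<in> A \<Longrightarrow> 2 * x < b - a \<or> b + a < 2 * x"
  shows "card A - 1 \<le> card (fresh_sums A)"
proof -
  define L where "L = {x \<in> A. 2 * x < b - a}"
  define H where "H = {x \<in> A. b + a < 2 * x \<and> x \<noteq> b}"
  have LH: "A - {b} = L \<union> H"
    using gap a_pos a_less_b unfolding L_def H_def by force
  have disj: "L \<inter> H = {}" unfolding L_def H_def using a_pos by auto
  have finLH: "finite L" "finite H" unfolding L_def H_def using fin by auto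
  have card_LH: "card L + card H = card A - 1"
    using card_Un_disjoint[OF finLH disj] LH fin b_in by (metis card_Diff_singleton)
  show ?thesis
  proof (cases "\<exists>l\<in>L. \<exists>h\<in>H. a + 2 * h = b + 2 * l")
    case False
    let ?g = "\<lambda>y. if y \<in> L then b + 2 * y else a + 2 * y"
    have "card (L \<union> H) \<le> card (fresh_sums A)"
    proof (rule card_fresh_ge)
      show "inj_on ?g (L \<union> H)"
        using False disj unfolding inj_on_def by (auto split: if_splits) metis+
      show "?g ` (L \<union> H) \<subseteq> fresh_sums A"
      proof
        fix z assume "z \<in> ?g ` (L \<union> H)"
        then obtain y where y: "y \<in> L \<union> H" "z = ?g y" by blast
        show "z \<in> fresh_sums A"
        proof (cases "y \<in> L")
          case True
          hence *: "y \<in> A" "2 * y < b - a" unfolding L_def by auto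
          have "a \<le> y" using a_le * by simp
          show ?thesis
            by (rule fresh_memI[OF b_in *(1)]) (use * y True \<open>a \<le> y\<close> a_pos le_b[of z] in auto)
        next
          case False
          hence *: "y \<in> A" "b + a < 2 * y" "y \<noteq> b" using y unfolding H_def by auto
          show ?thesis
            by (rule fresh_memI[OF a_in *(1)]) (use * y False a_pos a_less_b le_b[of z] le_b[of y] in auto)
        qed
      qed
    qed
    thus ?thesis using card_LH card_Un_disjoint[OF finLH disj] by simp
  next
    case True
    then obtain l h where l: "l \<in> A" "2 * l < b - a" and h: "h \<in> A" "h \<noteq> b"
      and lh: "a + 2 * h = b + 2 * l" and h2: "b + a < 2 * h"
      unfolding L_def H_def by blast
    have al: "a < l" using lh h2 by linarith
    have hb: "h < b" using le_b[OF h(1)] h(2) by simp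
    let ?f = "\<lambda>i. if b + 2 * a \<le> i + 2 * l then i + 2 * l else i + 2 * h"
    txt \<open>Since \<open>2h = 2l + (b - a)\<close>, the map reduces \<open>i + 2l\<close> modulo \<open>b - a\<close> to a window of
      that length; at most one \<open>i\<close> would need \<open>i = j\<close>.\<close>
    define w where "w = (if b + 2 * a \<le> 3 * l then l else h)"
    let ?B = "A - {b, w}"
    have w_in: "w \<in> A" "w \<noteq> b" unfolding w_def using l h al hb a_pos by auto
    have inj: "inj_on ?f ?B"
    proof (rule inj_onI)
      fix i j assume ij: "i \<in> ?B" "j \<in> ?B" "?f i = ?f j"
      have "i < b" "j < b" "a \<le> i" "a \<le> j" using ij le_b a_le by force+
      thus "i = j" using ij(3) lh by (auto split: if_splits)
    qed
    have f_ge: "b + 2 * a \<le> ?f i" if "i \<in> A" for i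
      using a_le[OF that] lh l al a_pos by auto
    have sub: "?f ` ?B \<subseteq> fresh_sums A"
    proof
      fix z assume "z \<in> ?f ` ?B"
      then obtain i where i: "i \<in> A" "i \<noteq> b" "i \<noteq> w" and z: "z = ?f i" by blast
      have ib: "i < b" using le_b[OF i(1)] i by simp
      have nA: "z \<notin> A" using f_ge[OF i(1)] z le_b[of z] a_pos by force
      show "z \<in> fresh_sums A"
      proof (cases "b + 2 * a \<le> i + 2 * l")
        case True
        show ?thesis
          by (rule fresh_memI[OF i(1) l(1)]) (use True z nA ib l i a_pos in \<open>auto simp: w_def split: if_splits\<close>)
      next
        case False
        \<comment> \<open>If \<open>w = l\<close>, then
          \<open>h + 2 * l > 3 * l \<ge> b + 2 * a\<close> puts \<open>h\<close> in the other
          branch; if \<open>w = h\<close>, it has been removed.\<close>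
        have "i \<noteq> h" using False i(3) lh a_less_b unfolding w_def by (auto split: if_splits)
        thus ?thesis
          by (intro fresh_memI[OF i(1) h(1)]) (use False z nA ib lh in auto)
      qed
    qed
    have cardA: "card ?B + 1 = card A - 1"
    proof -
      have "card ?B = card A - card {b, w}" using w_in b_in by (intro card_Diff_subset) auto
      moreover have "card {b, w} = 2" using w_in by simp
      moreover have "card {a, l, b} \<le> card A" using fin a_in b_in l by (intro card_mono) auto
      moreover have "card {a, l, b} = 3" using al le_b l a_pos by force
      ultimately show ?thesis by simp
    qed
    have "\<exists>z. z \<in> fresh_sums A \<and> z \<notin> ?f ` ?B"
    proof (rule ccontr)
      assume "\<not> ?thesis"
      hence all: "\<And>z. z \<in> fresh_sums A \<Longrightarrow> z \<in> ?f ` ?B" by blast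
      have low: "b + 2 * a \<le> z" if "z \<in> fresh_sums A" for z
        using all[OF that] f_ge by blast
      have step: "\<And>y. y \<in> A \<Longrightarrow> y \<noteq> a \<Longrightarrow> y \<noteq> b \<Longrightarrow> y + 2 * a \<in> A"
        using closed_of_no_short_fresh[OF low] by blast
      have closed: "\<And>y. y \<in> A \<Longrightarrow> y \<noteq> a \<Longrightarrow> y + 2 * a \<le> b \<Longrightarrow> y + 2 * a \<in> A"
        using step a_pos by force
      \<comment> \<open>By \<open>2 * l < b - a\<close> this sum is below \<open>b\<close>, too
        small to be fresh.\<close>
      have l2: "a + 2 * l \<in> A"
      proof (rule ccontr)
        assume "a + 2 * l \<notin> A"
        hence "a + 2 * l \<in> fresh_sums A"
          using l al a_in a_less_b a_pos by (intro fresh_memI[of a l]) auto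
        from low[OF this] l a_pos show False by simp
      qed
      \<comment> \<open>Both \<open>l\<close> and \<open>a + 2 * l\<close> reach \<open>b\<close> in
        steps of \<open>2 * a\<close>, so their difference \<open>l + a\<close> is a multiple of
        \<open>2 * a\<close>.\<close>
      obtain p where p: "b = l + 2 * a * int p" using progression_to_max[OF step l(1)] al by auto
      obtain r where r: "b = (a + 2 * l) + 2 * a * int r"
        using progression_to_max[OF step l2] al a_pos by auto
      define s where "s = int p - int r"
      have ls: "l = 2 * a * s - a" using p r unfolding s_def by (simp add: algebra_simps)
      have bs: "b = 2 * a * (s + int p) - a" using p ls by (simp add: algebra_simps)
      define u where "u = s + int p"
      \<comment> \<open>Rounding up makes twice \<open>2 * a * v - a\<close> equal to
        \<open>b - a\<close> or \<open>b + a\<close>, according to the parity of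
        \<open>u\<close>.\<close>
      define v where "v = (u + 1) div 2"
      have uv: "2 * v = u \<or> 2 * v = u + 1" unfolding v_def by presburger
      have bu: "b = 2 * a * u - a" using bs unfolding u_def .
      have "2 * (2 * a * s) < 2 * a * u" using l(2) ls bu by linarith
      hence "2 * a * (2 * s) < 2 * a * u" by (simp add: algebra_simps)
      hence su: "2 * s < u" using a_pos by (simp add: mult_less_cancel_left_pos)
      have "0 < 2 * a * u" using bu a_pos a_less_b by linarith
      hence "0 < u" using a_pos by (simp add: zero_less_mult_iff)
      hence "v \<le> u" "s \<le> v" using uv su by linarith+
      txt \<open>The progression from \<open>l\<close> to \<open>b\<close> consists of odd multiples of \<open>a\<close>, so it cannot
        jump over the interval of length \<open>a\<close> around \<open>b / 2\<close> that the members avoid.\<close>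
      have eq: "l + 2 * a * int (nat (v - s)) = 2 * a * v - a"
        using \<open>s \<le> v\<close> ls by (simp add: algebra_simps)
      have "2 * a * v \<le> 2 * a * u" using \<open>v \<le> u\<close> a_pos by simp
      hence "2 * a * v - a \<in> A"
        using closed_add_mult[OF closed l(1), of "nat (v - s)"] al eq bu by simp
      from gap[OF this] have "2 * a * (2 * v) < 2 * a * u \<or> 2 * a * (u + 1) < 2 * a * (2 * v)"
        using bu by (simp add: algebra_simps)
      hence "2 * v < u \<or> u + 1 < 2 * v"
        using a_pos mult_less_cancel_left_pos[of "2 * a" "2 * v" u]
          mult_less_cancel_left_pos[of "2 * a" "u + 1" "2 * v"] by linarith
      thus False using uv by linarith
    qed
    then obtain z where "z \<in> fresh_sums A" "z \<notin> ?f ` ?B" by blast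
    from card_fresh_ge_Suc[OF inj sub this] fin cardA show ?thesis by simp
  qed
qed

text \<open>The cases compare \<open>2 * x\<close> with \<open>b - a\<close> and
  \<open>b + a\<close>. The exclusion is genuine: for \<open>{a, 3 * a, 5 * a}\<close> the only
  fresh sum is \<open>7 * a\<close>.\<close>

lemma card_fresh_sums:
  assumes "A \<noteq> {a, 3 * a, 5 * a}"
  shows "card A - 1 \<le> card (fresh_sums A)"
proof (cases "\<forall>x\<in>A. 2 * x < b - a \<or> b + a < 2 * x")
  case True
  thus ?thesis using fresh_if_half_avoided by blast
next
  case False
  then obtain x where x: "x \<in> A" "b - a \<le> 2 * x" "2 * x \<le> b + a" by force
  hence "2 * x = b + a \<or> 2 * x = b - a \<or> b - a < 2 * x \<and> 2 * x < b + a" by linarith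
  thus ?thesis
    using fresh_if_near_half fresh_if_upper_half fresh_if_lower_half assms x(1) by blast
qed

end

section \<open>Induction on the maximum for sums that omit one element\<close>

lemma omit_one_sums_insert_max:
  assumes ps: "positive_set (insert b A) a b" and "b \<notin> A"
  shows "card (omit_one_sums A) + card (omit_one_sums (insert b A) \<inter> {..<a + 2 * b})
    \<le> card (omit_one_sums (insert b A))"
proof -
  interpret positive_set "insert b A" a b by (rule ps)
  let ?E = "omit_one_sums (insert b A)"
  let ?S = "(\<lambda>z. z + 2 * b) ` omit_one_sums A"
  have finA: "finite A" using fin by simp
  have "?S \<subseteq> ?E \<inter> {a + 2 * b..}"
  proof (rule image_subsetI)
    fix z assume "z \<in> omit_one_sums A"
    then obtain i J where z: "z = i + 2 * \<Sum>J" "i \<in> A" "J \<subseteq> A - {i}"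
      unfolding omit_one_sums_def by blast
    have J: "finite J" "b \<notin> J" using z finA assms(2) finite_subset by blast+
    have "z + 2 * b \<in> ?E"
      by (rule omit_one_sums_memI[of i _ "insert b J"]) (use z J assms(2) in auto)
    moreover have "0 \<le> \<Sum>J" using a_le a_pos z by (intro sum_nonneg) force
    moreover have "a \<le> i" using a_le z by simp
    ultimately show "z + 2 * b \<in> ?E \<inter> {a + 2 * b..}" using z(1) by simp
  qed
  hence sub: "?S \<union> ?E \<inter> {..<a + 2 * b} \<subseteq> ?E" and disj: "?S \<inter> (?E \<inter> {..<a + 2 * b}) = {}"
    by auto
  have finS: "finite ?S" using finite_omit_one_sums[OF finA] by simp
  have finE: "finite ?E" using finite_omit_one_sums[OF fin] .
  have "card ?S = card (omit_one_sums A)" by (intro card_image) (simp add: inj_on_def)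
  thus ?thesis
    using card_mono[OF finE sub] card_Un_disjoint[OF finS _ disj] finE by simp
qed

lemma (in positive_set) card_omit_one_sums_window:
  assumes "A \<noteq> {a, 3 * a, 5 * a}"
  shows "2 * card A - 1 \<le> card (omit_one_sums A \<inter> {..<a + 2 * b})"
proof -
  have "A \<union> fresh_sums A \<subseteq> omit_one_sums A \<inter> {..<a + 2 * b}"
  proof
    fix z assume "z \<in> A \<union> fresh_sums A"
    thus "z \<in> omit_one_sums A \<inter> {..<a + 2 * b}"
    proof
      assume z: "z \<in> A"
      have "z \<in> omit_one_sums A" by (rule omit_one_sums_memI[OF z, of "{}"]) auto
      moreover have "z < a + 2 * b" using le_b[OF z] a_pos a_less_b by linarith
      ultimately show ?thesis by simp
    next
      assume "z \<in> fresh_sums A"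
      then obtain i j where z: "z = i + 2 * j" "i \<in> A" "j \<in> A" "i \<noteq> j" "z < a + 2 * b"
        unfolding fresh_sums_def Min_eq Max_eq by blast
      have "z \<in> omit_one_sums A" by (rule omit_one_sums_memI[OF z(2), of "{j}"]) (use z in auto)
      thus ?thesis using z(5) by simp
    qed
  qed
  hence "card (A \<union> fresh_sums A) \<le> card (omit_one_sums A \<inter> {..<a + 2 * b})"
    using finite_omit_one_sums[OF fin] by (intro card_mono) auto
  moreover have "card (A \<union> fresh_sums A) = card A + card (fresh_sums A)"
    using fin finite_fresh_sums[OF fin] by (intro card_Un_disjoint) (auto simp: fresh_sums_def)
  ultimately show ?thesis using card_fresh_sums[OF assms] by linarith
qed

text \<open>In this exceptional set \<open>9 * a\<close> is not attained, which leaves eight sums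
  where the square bound would ask for nine.\<close>

lemma omit_one_sums_135:
  assumes "0 < a"
  shows "{a, 3*a, 5*a, 7*a, 11*a, 13*a, 15*a, 17*a} \<subseteq> omit_one_sums {a, 3*a, 5*a}"
proof -
  let ?A = "{a, 3*a, 5*a}"
  have "a \<in> omit_one_sums ?A" by (rule omit_one_sums_memI[of a _ "{}"]) auto
  moreover have "3*a \<in> omit_one_sums ?A" by (rule omit_one_sums_memI[of "3*a" _ "{}"]) auto
  moreover have "5*a \<in> omit_one_sums ?A" by (rule omit_one_sums_memI[of "5*a" _ "{}"]) auto
  moreover have "7*a \<in> omit_one_sums ?A"
    by (rule omit_one_sums_memI[of a _ "{3*a}"]) (use assms in auto)
  moreover have "11*a \<in> omit_one_sums ?A"
    by (rule omit_one_sums_memI[of a _ "{5*a}"]) (use assms in auto)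
  moreover have "13*a \<in> omit_one_sums ?A"
    by (rule omit_one_sums_memI[of "3*a" _ "{5*a}"]) (use assms in auto)
  moreover have "15*a \<in> omit_one_sums ?A"
    by (rule omit_one_sums_memI[of "3*a" _ "{a, 5*a}"]) (use assms in auto)
  moreover have "17*a \<in> omit_one_sums ?A"
    by (rule omit_one_sums_memI[of a _ "{3*a, 5*a}"]) (use assms in auto)
  ultimately show ?thesis by blast
qed

lemma card_omit_one_sums_135:
  assumes "0 < a"
  shows "8 \<le> card (omit_one_sums {a, 3*a, 5*a})"
proof -
  have "card {a, 3*a, 5*a, 7*a, 11*a, 13*a, 15*a, 17*a} = 8" using assms by simp
  thus ?thesis
    using card_mono[OF _ omit_one_sums_135[OF assms]] finite_omit_one_sums[of "{a, 3*a, 5*a}"] by simp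
qed

text \<open>The deficit of the exceptional set disappears after one insertion: eight sums below
  \<open>a + 2 * c\<close> join the eight translated ones. Only \<open>c = 7 * a\<close> has just
  seven sums there, so its sixteen sums are listed.\<close>

lemma card_omit_one_sums_135_insert:
  assumes "0 < a" "5 * a < c"
  shows "16 \<le> card (omit_one_sums (insert c {a, 3*a, 5*a}))"
proof -
  let ?A = "{a, 3*a, 5*a}"
  let ?E = "omit_one_sums (insert c ?A)"
  have finE: "finite ?E" by (rule finite_omit_one_sums) simp
  have E3: "{a, 3*a, 5*a, 7*a, 11*a, 13*a, 15*a, 17*a} \<subseteq> ?E"
    using omit_one_sums_135[OF assms(1)] omit_one_sums_mono[of ?A "insert c ?A"] by blast
  have c0: "c \<in> ?E" by (rule omit_one_sums_memI[of c _ "{}"]) auto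
  have c1: "c + 2*a \<in> ?E" by (rule omit_one_sums_memI[of c _ "{a}"]) (use assms in auto)
  have c3: "c + 6*a \<in> ?E" by (rule omit_one_sums_memI[of c _ "{3*a}"]) (use assms in auto)
  show ?thesis
  proof (cases "c = 7 * a")
    case True
    have "9*a \<in> ?E" using c1 True by simp
    moreover have "19*a \<in> ?E"
      by (rule omit_one_sums_memI[of "5*a" _ "{c}"]) (use assms True in auto)
    moreover have "21*a \<in> ?E"
      by (rule omit_one_sums_memI[of "5*a" _ "{a, c}"]) (use assms True in auto)
    moreover have "23*a \<in> ?E"
      by (rule omit_one_sums_memI[of c _ "{3*a, 5*a}"]) (use assms True in auto)
    moreover have "25*a \<in> ?E"
      by (rule omit_one_sums_memI[of "a" _ "{5*a, c}"]) (use assms True in auto)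
    moreover have "27*a \<in> ?E"
      by (rule omit_one_sums_memI[of "3*a" _ "{5*a, c}"]) (use assms True in auto)
    moreover have "29*a \<in> ?E"
      by (rule omit_one_sums_memI[of "3*a" _ "{a, 5*a, c}"]) (use assms True in auto)
    moreover have "31*a \<in> ?E"
      by (rule omit_one_sums_memI[of "a" _ "{3*a, 5*a, c}"]) (use assms True in auto)
    ultimately have "{a, 3*a, 5*a, 7*a, 9*a, 11*a, 13*a, 15*a, 17*a, 19*a, 21*a, 23*a,
        25*a, 27*a, 29*a, 31*a} \<subseteq> ?E" using E3 by blast
    moreover have "card {a, 3*a, 5*a, 7*a, 9*a, 11*a, 13*a, 15*a, 17*a, 19*a, 21*a, 23*a,
        25*a, 27*a, 29*a, 31*a} = 16" using assms by simp
    ultimately show ?thesis using card_mono[OF finE] by metis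
  next
    case False
    interpret positive_set "insert c ?A" a c by unfold_locales (use assms in auto)
    have "8 \<le> card (?E \<inter> {..<a + 2 * c})"
    \<comment> \<open>For large \<open>c\<close> all eight old sums lie below the cutoff. Otherwise
      three of them may not, and \<open>c\<close>, \<open>c + 2 * a\<close>,
      \<open>c + 6 * a\<close> replace them; these are new because
      \<open>c \<noteq> 7 * a\<close>.\<close>
    proof (cases "c > 8 * a")
      case True
      have "{a, 3*a, 5*a, 7*a, 11*a, 13*a, 15*a, 17*a} \<subseteq> ?E \<inter> {..<a + 2 * c}"
        using E3 True assms by auto
      moreover have "card {a, 3*a, 5*a, 7*a, 11*a, 13*a, 15*a, 17*a} = 8" using assms by simp
      ultimately show ?thesis using card_mono[of "?E \<inter> {..<a + 2 * c}"] finE by (metis finite_Int)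
    next
      case c8: False
      have "{a, 3*a, 5*a, 7*a, 11*a, c, c + 2*a, c + 6*a} \<subseteq> ?E \<inter> {..<a + 2 * c}"
        using E3 c0 c1 c3 assms by auto
      moreover have "card {a, 3*a, 5*a, 7*a, 11*a, c, c + 2*a, c + 6*a} = 8"
        using assms c8 False by simp
      ultimately show ?thesis using card_mono[of "?E \<inter> {..<a + 2 * c}"] finE by (metis finite_Int)
    qed
    moreover have "c \<notin> ?A" using assms by auto
    ultimately show ?thesis
      using omit_one_sums_insert_max[OF positive_set_axioms] card_omit_one_sums_135[OF assms(1)]
      by linarith
  qed
qed

text \<open>With \<open>n = card A\<close> before the insertion, the window contributes
  \<open>2 * n + 1\<close>, the gap between consecutive squares. If the smaller set is exceptional,
  the direct count for four elements takes over.\<close>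

lemma card_omit_one_sums:
  assumes "finite A" "A \<noteq> {}" "\<forall>x\<in>A. 0 < x" "\<And>a. A \<noteq> {a, 3 * a, 5 * a}"
  shows "(card A)\<^sup>2 \<le> card (omit_one_sums A)"
  using assms
proof (induction A rule: finite_linorder_max_induct)
  case empty
  thus ?case by simp
next
  case (insert b A)
  show ?case
  proof (cases "A = {}")
    case True
    have "{b} \<subseteq> omit_one_sums {b}" using omit_one_sums_memI[of b "{b}" "{}" b] by simp
    from card_mono[OF finite_omit_one_sums this] show ?thesis using True by simp
  next
    case False
    define a where "a = Min A"
    have a: "a \<in> A" "\<And>x. x \<in> A \<Longrightarrow> a \<le> x" using insert.hyps(1) False unfolding a_def by auto
    have bA: "b \<notin> A" using insert.hyps by auto
    interpret positive_set "insert b A" a b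
      by unfold_locales (use a insert.hyps insert.prems in \<open>auto intro: less_imp_le\<close>)
    show ?thesis
    proof (cases "\<exists>d. A = {d, 3 * d, 5 * d}")
      case True
      then obtain d where d: "A = {d, 3 * d, 5 * d}" by blast
      hence d0: "0 < d" "5 * d < b" using insert.prems insert.hyps by auto
      have "card (insert b A) = 4" using d d0 by auto
      thus ?thesis using card_omit_one_sums_135_insert[OF d0] d by simp
    next
      case no: False
      have IH: "(card A)\<^sup>2 \<le> card (omit_one_sums A)" using insert no False by auto
      have "2 * card (insert b A) - 1 \<le> card (omit_one_sums (insert b A) \<inter> {..<a + 2 * b})"
        using card_omit_one_sums_window insert.prems by blast
      with IH omit_one_sums_insert_max[OF positive_set_axioms bA] bA insert.hyps(1)
      show ?thesis by (simp add: power2_eq_square algebra_simps)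
    qed
  qed
qed

section \<open>Lower bound for restricted signed sumsets\<close>

lemma restricted_signed_sumset_memI:
  assumes "\<forall>a\<in>A. c a \<in> {-1, 0, 1}" "(\<Sum>a\<in>A. \<bar>c a\<bar>) = int h" "z = (\<Sum>a\<in>A. c a * a)"
  shows "z \<in> restricted_signed_sumset h A"
  unfolding restricted_signed_sumset_def using assms by blast

lemma restricted_signed_sumset_memE:
  assumes "z \<in> restricted_signed_sumset h A"
  obtains c where "\<forall>a\<in>A. c a \<in> {-1, 0, 1}" "(\<Sum>a\<in>A. \<bar>c a\<bar>) = int h" "z = (\<Sum>a\<in>A. c a * a)"
  using assms unfolding restricted_signed_sumset_def by blast

lemma restricted_signed_sumset_uminus:
  assumes "z \<in> restricted_signed_sumset h A"
  shows "- z \<in> restricted_signed_sumset h A"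
proof -
  obtain c where c: "\<forall>a\<in>A. c a \<in> {-1, 0, 1}" "(\<Sum>a\<in>A. \<bar>c a\<bar>) = int h" "z = (\<Sum>a\<in>A. c a * a)"
    using assms by (rule restricted_signed_sumset_memE)
  show ?thesis
    by (rule restricted_signed_sumset_memI[of A "\<lambda>a. - c a"]) (use c in \<open>auto simp: sum_negf\<close>)
qed

lemma finite_restricted_signed_sumset:
  assumes "finite A"
  shows "finite (restricted_signed_sumset h A)"
proof (rule finite_subset)
  show "restricted_signed_sumset h A \<subseteq> {- (\<Sum>a\<in>A. \<bar>a\<bar>)..\<Sum>a\<in>A. \<bar>a\<bar>}"
  proof
    fix z assume "z \<in> restricted_signed_sumset h A"
    then obtain c where c: "\<forall>a\<in>A. c a \<in> {-1, 0, 1}" "z = (\<Sum>a\<in>A. c a * a)"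
      by (rule restricted_signed_sumset_memE)
    have "\<bar>z\<bar> \<le> (\<Sum>a\<in>A. \<bar>c a * a\<bar>)" unfolding c(2) by (rule sum_abs)
    also have "\<dots> \<le> (\<Sum>a\<in>A. \<bar>a\<bar>)" by (rule sum_mono) (use c in auto)
    finally show "z \<in> {- (\<Sum>a\<in>A. \<bar>a\<bar>)..\<Sum>a\<in>A. \<bar>a\<bar>}" by auto
  qed
qed simp

text \<open>Coefficients absorb the signs of the elements. A zero element would lose its coefficient
  through \<open>sgn 0 = 0\<close>, hence \<open>0 \<notin> A\<close>.\<close>

lemma restricted_signed_sumset_abs_subset:
  assumes "inj_on abs A" "0 \<notin> A"
  shows "restricted_signed_sumset h (abs ` A) \<subseteq> restricted_signed_sumset h A"
proof
  fix z assume "z \<in> restricted_signed_sumset h (abs ` A)"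
  then obtain c where c: "\<forall>a\<in>abs ` A. c a \<in> {-1, 0, 1}" "(\<Sum>a\<in>abs ` A. \<bar>c a\<bar>) = int h"
    "z = (\<Sum>a\<in>abs ` A. c a * a)" by (rule restricted_signed_sumset_memE)
  show "z \<in> restricted_signed_sumset h A"
  proof (rule restricted_signed_sumset_memI[of A "\<lambda>a. c \<bar>a\<bar> * sgn a"])
    show "\<forall>a\<in>A. c \<bar>a\<bar> * sgn a \<in> {- 1, 0, 1}" using c(1) by (auto simp: sgn_if)
    have "(\<Sum>a\<in>A. \<bar>c \<bar>a\<bar> * sgn a\<bar>) = (\<Sum>a\<in>A. \<bar>c \<bar>a\<bar>\<bar>)"
      by (rule sum.cong) (use assms(2) in \<open>auto simp: abs_mult abs_sgn_eq\<close>)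
    thus "(\<Sum>a\<in>A. \<bar>c \<bar>a\<bar> * sgn a\<bar>) = int h" using c(2) by (simp add: sum.reindex[OF assms(1)])
    have "(\<Sum>a\<in>A. c \<bar>a\<bar> * sgn a * a) = (\<Sum>a\<in>A. c \<bar>a\<bar> * \<bar>a\<bar>)"
      by (rule sum.cong) (auto simp: abs_sgn mult.assoc mult.commute)
    thus "z = (\<Sum>a\<in>A. c \<bar>a\<bar> * sgn a * a)" using c(3) by (simp add: sum.reindex[OF assms(1)])
  qed
qed

text \<open>Start from all signs negative, with value \<open>- \<Sum>A\<close>: omitting
  \<open>i\<close> adds \<open>i\<close>, and turning the signs on \<open>J\<close> adds
  \<open>2 * \<Sum>J\<close>.\<close>

lemma card_omit_one_sums_le:
  assumes "finite A" "card A = h + 1"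
  shows "card (omit_one_sums A) \<le> card (restricted_signed_sumset h A)"
proof (rule card_inj_on_le)
  show "inj_on (\<lambda>z. z - \<Sum>A) (omit_one_sums A)" by (simp add: inj_on_def)
  show "finite (restricted_signed_sumset h A)" by (rule finite_restricted_signed_sumset[OF assms(1)])
  show "(\<lambda>z. z - \<Sum>A) ` omit_one_sums A \<subseteq> restricted_signed_sumset h A"
  proof (rule image_subsetI)
    fix z assume "z \<in> omit_one_sums A"
    then obtain i J where z: "z = i + 2 * \<Sum>J" "i \<in> A" "J \<subseteq> A - {i}"
      unfolding omit_one_sums_def by blast
    define c :: "int \<Rightarrow> int" where "c a = (if a = i then 0 else if a \<in> J then 1 else - 1)" for a
    show "z - \<Sum>A \<in> restricted_signed_sumset h A"
    proof (rule restricted_signed_sumset_memI[of A c])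
      show "\<forall>a\<in>A. c a \<in> {- 1, 0, 1}" unfolding c_def by simp
      have "(\<Sum>a\<in>A. \<bar>c a\<bar>) = (\<Sum>a\<in>A - {i}. 1)"
        by (rule sum.mono_neutral_cong_right) (use assms in \<open>auto simp: c_def\<close>)
      thus "(\<Sum>a\<in>A. \<bar>c a\<bar>) = int h" using assms z(2) by simp
      have "(\<Sum>a\<in>A. c a * a) = (\<Sum>a\<in>A. ((if a = i then a else 0) + 2 * (if a \<in> J then a else 0)) - a)"
        by (rule sum.cong) (use z in \<open>auto simp: c_def\<close>)
      also have "\<dots> = (\<Sum>a\<in>A. if a = i then a else 0) + 2 * (\<Sum>a\<in>A. if a \<in> J then a else 0) - \<Sum>A"
        by (simp add: sum_subtractf sum.distrib sum_distrib_left)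
      also have "(\<Sum>a\<in>A. if a = i then a else 0) = i" using assms z by simp
      also have "(\<Sum>a\<in>A. if a \<in> J then a else 0) = \<Sum>J"
        using assms z by (simp add: sum.inter_restrict[symmetric] Int_absorb1 Diff_subset subset_trans)
      finally show "z - \<Sum>A = (\<Sum>a\<in>A. c a * a)" using z(1) by simp
    qed
  qed
qed

lemma restricted_signed_sumset_nonempty:
  assumes "finite A" "h \<le> card A"
  shows "restricted_signed_sumset h A \<noteq> {}"
proof -
  obtain T where T: "T \<subseteq> A" "card T = h" using assms obtain_subset_with_card_n by metis
  have "(\<Sum>a\<in>A. \<bar>if a \<in> T then 1 else 0 :: int\<bar>) = (\<Sum>a\<in>T. 1)"
    by (rule sum.mono_neutral_cong_right) (use assms T in auto)
  hence "(\<Sum>a\<in>A. (if a \<in> T then 1 else 0) * a) \<in> restricted_signed_sumset h A"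
    using T by (intro restricted_signed_sumset_memI[of A "\<lambda>a. if a \<in> T then 1 else 0"]) auto
  thus ?thesis by blast
qed

text \<open>Exchanging any one of the \<open>h\<close> terms of the largest sum for the new maximum gives \<open>h\<close>
  sums above all old ones, and symmetrically below.\<close>

lemma card_restricted_signed_sumset_insert_max:
  assumes fin: "finite A" and pos: "\<forall>x\<in>A. 0 < x" and h: "h \<le> card A" and b: "\<forall>x\<in>A. x < b"
  shows "card (restricted_signed_sumset h A) + 2 * h \<le> card (restricted_signed_sumset h (insert b A))"
proof -
  let ?S = "restricted_signed_sumset h A" and ?S' = "restricted_signed_sumset h (insert b A)"
  have bA: "b \<notin> A" using b by auto
  have finS: "finite ?S" and finS': "finite ?S'"
    using finite_restricted_signed_sumset fin by auto
  have ne: "?S \<noteq> {}" using restricted_signed_sumset_nonempty fin h by blast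
  define M where "M = Max ?S"
  have MS: "M \<in> ?S" and M_ge: "\<And>z. z \<in> ?S \<Longrightarrow> z \<le> M"
    using finS ne unfolding M_def by auto
  \<comment> \<open>Symmetry makes \<open>- M\<close> the minimum and \<open>M\<close> nonnegative,
    which later separates the new sums above from those below.\<close>
  have M_le: "- M \<le> z" if "z \<in> ?S" for z
    using M_ge[OF restricted_signed_sumset_uminus[OF that]] by simp
  have M0: "0 \<le> M" using M_le[OF MS] by simp
  obtain c where c: "\<forall>a\<in>A. c a \<in> {-1, 0, 1}" "(\<Sum>a\<in>A. \<bar>c a\<bar>) = int h" "M = (\<Sum>a\<in>A. c a * a)"
    using MS by (rule restricted_signed_sumset_memE)
  define T where "T = {a \<in> A. c a \<noteq> 0}"
  have finT: "finite T" unfolding T_def using fin by simp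
  have "(\<Sum>a\<in>A. \<bar>c a\<bar>) = (\<Sum>a\<in>T. 1)"
    by (rule sum.mono_neutral_cong_right) (use fin c(1) in \<open>auto simp: T_def\<close>)
  hence cardT: "card T = h" using c(2) by simp
  let ?g = "\<lambda>t. M - c t * t + b"
  have T: "t \<in> A" "c t = 1 \<or> c t = -1" "0 < t" "t < b" if "t \<in> T" for t
    using that c(1) pos b unfolding T_def by auto
  have g_gt: "M < ?g t" if "t \<in> T" for t
    using T[OF that] by auto
  have g_inj: "inj_on ?g T"
  proof (rule inj_onI)
    fix s t assume st: "s \<in> T" "t \<in> T" "?g s = ?g t"
    hence "c s * s = c t * t" by simp
    thus "s = t" using T[OF st(1)] T[OF st(2)] by auto
  qed
  have old: "?S \<subseteq> ?S'"
  proof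
    fix z assume "z \<in> ?S"
    then obtain d where d: "\<forall>a\<in>A. d a \<in> {-1, 0, 1}" "(\<Sum>a\<in>A. \<bar>d a\<bar>) = int h" "z = (\<Sum>a\<in>A. d a * a)"
      by (rule restricted_signed_sumset_memE)
    have "(\<Sum>a\<in>A. \<bar>(d(b := 0)) a\<bar>) = (\<Sum>a\<in>A. \<bar>d a\<bar>)" "(\<Sum>a\<in>A. (d(b := 0)) a * a) = (\<Sum>a\<in>A. d a * a)"
      by (rule sum.cong; use bA in auto)+
    thus "z \<in> ?S'"
      by (intro restricted_signed_sumset_memI[of _ "d(b := 0)"]) (use d fin bA in auto)
  qed
  have g_in: "?g t \<in> ?S'" if t: "t \<in> T" for t
  proof (rule restricted_signed_sumset_memI[of _ "c(b := 1, t := 0)"])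
    let ?c = "c(b := 1, t := 0)"
    have tb: "t \<noteq> b" "t \<in> A" using T[OF t] by auto
    show "\<forall>a\<in>insert b A. ?c a \<in> {- 1, 0, 1}" using c(1) by auto
    have 1: "(\<Sum>a\<in>A. \<bar>?c a\<bar>) = (\<Sum>a\<in>A - {t}. \<bar>c a\<bar>)"
      by (rule sum.mono_neutral_cong_right) (use fin bA in auto)
    have "\<bar>c t\<bar> = 1" using T[OF t] by auto
    hence "(\<Sum>a\<in>A - {t}. \<bar>c a\<bar>) = int h - 1" using c(2) fin tb by (simp add: sum_diff1)
    thus "(\<Sum>a\<in>insert b A. \<bar>?c a\<bar>) = int h" using fin bA tb 1 by simp
    have "(\<Sum>a\<in>A. ?c a * a) = (\<Sum>a\<in>A - {t}. c a * a)"
      by (rule sum.mono_neutral_cong_right) (use fin bA in auto)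
    also have "\<dots> = M - c t * t" using c(3) fin tb by (simp add: sum_diff1)
    finally show "?g t = (\<Sum>a\<in>insert b A. ?c a * a)" using fin bA tb by simp
  qed
  let ?P = "?g ` T" and ?N = "(\<lambda>t. - ?g t) ` T"
  have "inj_on (\<lambda>t. - ?g t) T" using g_inj by (simp add: inj_on_def)
  hence cards: "card ?P = h" "card ?N = h" using card_image[OF g_inj] card_image cardT by metis+
  have P_gt: "M < z" if "z \<in> ?P" for z using that g_gt by blast
  have N_less: "z < - M" if "z \<in> ?N" for z using that g_gt by (force simp del: minus_diff_eq minus_add_distrib)
  have "z \<notin> ?N" if "z \<in> ?P" for z using P_gt[OF that] N_less[of z] M0 by linarith
  hence "?P \<inter> ?N = {}" by blast
  hence PN: "card (?P \<union> ?N) = 2 * h" using cards finT by (simp add: card_Un_disjoint)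
  have "z \<notin> ?P \<union> ?N" if "z \<in> ?S" for z
    using P_gt[of z] N_less[of z] M_ge[OF that] M_le[OF that] by (meson UnE linorder_not_less)
  hence "?S \<inter> (?P \<union> ?N) = {}" by blast
  hence "card (?S \<union> (?P \<union> ?N)) = card ?S + 2 * h" using PN finS finT by (simp add: card_Un_disjoint)
  moreover have "?S \<union> (?P \<union> ?N) \<subseteq> ?S'"
    using old g_in restricted_signed_sumset_uminus by blast
  note card_mono[OF finS' this]
  ultimately show ?thesis by linarith
qed

text \<open>At \<open>card A = h + 1\<close> the bound is \<open>(h + 1)\<^sup>2\<close>, and each
  further maximum adds \<open>2 * h\<close>. By \<open>3 \<le> h\<close> the base case has at least
  four elements, so the exceptional set cannot occur. Moving \<open>h\<^sup>2\<close> to the right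
  avoids truncated subtraction.\<close>

lemma card_restricted_signed_sumset_positive:
  assumes "3 \<le> h" "finite A" "\<forall>x\<in>A. 0 < x" "h + 1 \<le> card A"
  shows "2 * h * card A + 1 \<le> card (restricted_signed_sumset h A) + h\<^sup>2"
  using assms(2-4)
proof (induction A rule: finite_linorder_max_induct)
  case empty
  thus ?case by simp
next
  case (insert b A)
  have cardb: "card (insert b A) = card A + 1" using insert.hyps by auto
  show ?case
  proof (cases "card A = h")
    case True
    have "insert b A \<noteq> {a, 3 * a, 5 * a}" for a
    proof
      assume eq: "insert b A = {a, 3 * a, 5 * a}"
      have "card {a, 3 * a, 5 * a} \<le> 3" by (simp add: card_insert_if)
      thus False using eq cardb True assms(1) by simp
    qed
    hence "(h + 1)\<^sup>2 \<le> card (omit_one_sums (insert b A))"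
      using card_omit_one_sums[of "insert b A"] insert cardb True by simp
    also have "\<dots> \<le> card (restricted_signed_sumset h (insert b A))"
      using card_omit_one_sums_le[of "insert b A" h] insert.hyps cardb True by simp
    finally show ?thesis using cardb True by (simp add: power2_eq_square algebra_simps)
  next
    case False
    hence "h + 1 \<le> card A" using insert.prems cardb by simp
    thus ?thesis
      using insert card_restricted_signed_sumset_insert_max[of A h b] cardb
      by (simp add: algebra_simps)
  qed
qed

section \<open>Sharpness: the first \<open>k\<close> odd numbers\<close>

text \<open>The extremal choice is the \<open>m = card I\<close> largest odd numbers below
  \<open>2 * k\<close>, with sum \<open>k\<^sup>2 - (k - m)\<^sup>2\<close>.\<close>

lemma sum_odd_subset:
  assumes "I \<subseteq> {..<k}"
  shows "(\<Sum>i\<in>I. 2 * int i + 1) + (int (card I))\<^sup>2 \<le> 2 * int k * int (card I)"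
  using assms
proof (induction k arbitrary: I)
  case 0
  thus ?case by simp
next
  case (Suc k)
  have finI: "finite I" using Suc.prems finite_subset by blast
  show ?case
  proof (cases "k \<in> I")
    case True
    let ?J = "I - {k}"
    have "?J \<subseteq> {..<k}" using Suc.prems by auto
    note IH = Suc.IH[OF this]
    have "card I = card ?J + 1" using True finI by (metis card.remove Suc_eq_plus1)
    moreover have "(\<Sum>i\<in>I. 2 * int i + 1) = 2 * int k + 1 + (\<Sum>i\<in>?J. 2 * int i + 1)"
      using True finI by (simp add: sum.remove)
    ultimately show ?thesis using IH by (simp add: power2_eq_square algebra_simps)
  next
    case False
    hence "I \<subseteq> {..<k}" using Suc.prems by (auto simp: less_Suc_eq)
    note IH = Suc.IH[OF this]
    thus ?thesis by (simp add: algebra_simps)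
  qed
qed

text \<open>All sums lie between \<open>- M\<close> and \<open>M\<close> and have the parity of
  \<open>M\<close>, which leaves \<open>M + 1\<close> values.\<close>

lemma card_restricted_signed_sumset_odd:
  assumes "h \<le> k"
  shows "int (card (restricted_signed_sumset h ((\<lambda>i. 2 * int i + 1) ` {..<k})))
    \<le> 2 * int h * int k - (int h)\<^sup>2 + 1"
proof -
  let ?o = "\<lambda>i::nat. 2 * int i + 1"
  let ?S = "restricted_signed_sumset h (?o ` {..<k})"
  define M where "M = 2 * int h * int k - (int h)\<^sup>2"
  have inj: "inj_on ?o {..<k}" by (simp add: inj_on_def)
  have M0: "0 \<le> M"
  proof -
    have "int h * int h \<le> int h * (2 * int k)" using assms by (intro mult_left_mono) auto
    thus ?thesis unfolding M_def by (simp add: power2_eq_square algebra_simps)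
  qed
  have "?S \<subseteq> (\<lambda>j. 2 * int j - M) ` {..nat M}"
  proof
    fix z assume "z \<in> ?S"
    then obtain c where c: "\<forall>a\<in>?o ` {..<k}. c a \<in> {-1, 0, 1}" "(\<Sum>a\<in>?o ` {..<k}. \<bar>c a\<bar>) = int h"
      "z = (\<Sum>a\<in>?o ` {..<k}. c a * a)" by (rule restricted_signed_sumset_memE)
    have ch: "(\<Sum>i<k. \<bar>c (?o i)\<bar>) = int h" and cz: "z = (\<Sum>i<k. c (?o i) * ?o i)"
      using c by (simp_all add: sum.reindex[OF inj])
    have c01: "c (?o i) \<in> {-1, 0, 1}" if "i < k" for i using c(1) that by auto
    define I where "I = {i. i < k \<and> c (?o i) \<noteq> 0}"
    have I: "I \<subseteq> {..<k}" unfolding I_def by auto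
    have "(\<Sum>i<k. \<bar>c (?o i)\<bar>) = (\<Sum>i\<in>I. 1)"
      by (rule sum.mono_neutral_cong_right) (use c01 in \<open>force simp: I_def\<close>)+
    hence cardI: "card I = h" using ch by simp
    have "\<bar>z\<bar> \<le> (\<Sum>i<k. \<bar>c (?o i) * ?o i\<bar>)" unfolding cz by (rule sum_abs)
    also have "\<dots> = (\<Sum>i\<in>I. ?o i)"
      by (rule sum.mono_neutral_cong_right) (use c01 in \<open>force simp: I_def abs_mult\<close>)+
    also have "\<dots> \<le> M" using sum_odd_subset[OF I] unfolding cardI M_def by (simp add: algebra_simps)
    finally have zM: "- M \<le> z" "z \<le> M" by auto
    \<comment> \<open>Multiplying a coefficient by an odd number or taking its absolute value
      preserves its parity, so the difference is even term by term.\<close>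
    have "even (z - (\<Sum>i<k. \<bar>c (?o i)\<bar>))"
      unfolding cz sum_subtractf[symmetric] by (rule dvd_sum) (use c01 in force)
    hence "even (z - int h)" using ch by simp
    moreover have "even (M - int h)" unfolding M_def by (simp add: power2_eq_square)
    ultimately have "even (z + M)" by presburger
    then obtain j where j: "z + M = 2 * j" by (elim evenE)
    hence "z = 2 * int (nat j) - M" "nat j \<le> nat M" using zM by auto
    thus "z \<in> (\<lambda>j. 2 * int j - M) ` {..nat M}" by blast
  qed
  hence "card ?S \<le> card {..nat M}" using surj_card_le[OF finite_atMost] by blast
  thus ?thesis using M0 unfolding M_def by simp
qed

theorem theorem3:
  fixes h k :: nat
  assumes "3 \<le> h" and "h \<le> k - 1"
  shows "(\<forall>A :: int set. finite A \<and> card A = k \<and> A \<inter> uminus ` A = {} \<longrightarrow>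
            int (card (restricted_signed_sumset h A)) \<ge> 2 * int h * int k - (int h)\<^sup>2 + 1)
       \<and> (\<exists>A :: int set. finite A \<and> card A = k \<and> A \<inter> uminus ` A = {} \<and>
            int (card (restricted_signed_sumset h A)) = 2 * int h * int k - (int h)\<^sup>2 + 1)"
proof -
  have lower: "2 * int h * int k - (int h)\<^sup>2 + 1 \<le> int (card (restricted_signed_sumset h A))"
    if A: "finite A" "card A = k" "A \<inter> uminus ` A = {}" for A :: "int set"
  proof -
    \<comment> \<open>Disjointness from the negatives excludes \<open>0\<close> and makes
      \<open>abs\<close> injective on \<open>A\<close>, so the bound for the positive set of
      absolute values transfers.\<close>
    have neg: "- x \<notin> A" if "x \<in> A" for x using A(3) that by force
    have nz: "0 \<notin> A" using neg[of 0] by auto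
    have inj: "inj_on abs A"
    proof (rule inj_onI)
      fix x y :: int assume "x \<in> A" "y \<in> A" "\<bar>x\<bar> = \<bar>y\<bar>"
      thus "x = y" using neg[of y] by (auto simp: abs_eq_iff)
    qed
    have "2 * h * card (abs ` A) + 1 \<le> card (restricted_signed_sumset h (abs ` A)) + h\<^sup>2"
      by (rule card_restricted_signed_sumset_positive) (use assms A nz card_image[OF inj] in auto)
    moreover have "card (restricted_signed_sumset h (abs ` A)) \<le> card (restricted_signed_sumset h A)"
      by (rule card_mono[OF finite_restricted_signed_sumset[OF A(1)]
            restricted_signed_sumset_abs_subset[OF inj nz]])
    ultimately have "2 * h * k + 1 \<le> card (restricted_signed_sumset h A) + h\<^sup>2"
      using card_image[OF inj] A(2) by simp
    hence "int (2 * h * k + 1) \<le> int (card (restricted_signed_sumset h A) + h\<^sup>2)" by (rule iffD2[OF of_nat_le_iff])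
    thus ?thesis by simp
  qed
  let ?O = "(\<lambda>i. 2 * int i + 1) ` {..<k}"
  have O: "finite ?O" "card ?O = k" "?O \<inter> uminus ` ?O = {}"
    by (auto simp: card_image inj_on_def)
  have "int (card (restricted_signed_sumset h ?O)) = 2 * int h * int k - (int h)\<^sup>2 + 1"
    using lower[OF O] card_restricted_signed_sumset_odd[of h k] assms by linarith
  thus ?thesis using lower O by blast
qed

end
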